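(* Let $(M^{2n},g,J)$ be a quasi-Kähler manifold in the class $\mathcal{AH}_2$. Then $$\overline{\nabla}_{T_XY}\,\eta=0$$ for all $X,Y\in TM$.
   Context: An almost Hermitian manifold $(M^{2n},g,J)$ is a Riemannian manifold with a $g$-compatible almost complex structure; $\nabla$ is the Levi-Civita connection. It is quasi-Kähler if $\nabla_{JX}J=-J\nabla_XJ$ for all $X$. Curvature: $R(X,Y)=\nabla_{[X,Y]}-[\nabla_X,\nabla_Y]$, $R(X,Y,Z,U)=g(R(X,Y)Z,U)$. The class $\mathcal{AH}_2$ consists of the almost Hermitian manifolds with $R(X,Y,Z,U)-R(JX,JY,Z,U)=R(JX,Y,JZ,U)+R(JX,Y,Z,JU)$ for all $X,Y,Z,U$. Set $\eta_XY=\tfrac12(\nabla_XJ)JY$, $\overline{\nabla}_XY=\nabla_XY+\eta_XY$ (first canonical Hermitian connection), with torsion $T_XY=\eta_XY-\eta_YX$. *)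

theory Defs
  imports "HOL-Analysis.Analysis" "HOL-Library.Function_Algebras"
begin

section \<open>Smooth manifolds\<close>

text \<open>Smoothness of maps between normed spaces; meant for an open set \<open>S\<close>, where it is the
  existence and continuity of all iterated directional derivatives.\<close>

primrec Ck_on :: "nat \<Rightarrow> 'b::real_normed_vector set \<Rightarrow> ('b \<Rightarrow> 'c::real_normed_vector) \<Rightarrow> bool" where
  "Ck_on 0 S f \<longleftrightarrow> continuous_on S f"
| "Ck_on (Suc k) S f \<longleftrightarrow> (\<forall>x\<in>S. f differentiable (at x)) \<and>
     (\<forall>v. Ck_on k S (\<lambda>x. frechet_derivative f (at x) v))"

definition smooth_on :: "'b::real_normed_vector set \<Rightarrow> ('b \<Rightarrow> 'c::real_normed_vector) \<Rightarrow> bool" where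
  "smooth_on S f \<longleftrightarrow> (\<forall>k. Ck_on k S f)"

text \<open>The manifold is the whole type \<open>'a\<close>. A chart is a pair \<open>(U, \<phi>)\<close>; values of \<open>\<phi>\<close> outside \<open>U\<close>
  are irrelevant. Hausdorffness and second countability come from the type classes; connectedness
  is not required.\<close>

type_synonym ('a, 'e) chart = "'a set \<times> ('a \<Rightarrow> 'e)"

definition smooth_manifold ::
    "('a::{t2_space,second_countable_topology}, 'e::euclidean_space) chart set \<Rightarrow> bool" where
  "smooth_manifold A \<longleftrightarrow>
     (\<Union>(U, \<phi>)\<in>A. U) = UNIV \<and>
     (\<forall>(U, \<phi>)\<in>A. open U \<and> open (\<phi> ` U) \<and> homeomorphism U (\<phi> ` U) \<phi> (inv_into U \<phi>)) \<and>
     (\<forall>(U, \<phi>)\<in>A. \<forall>(V, \<psi>)\<in>A. smooth_on (\<phi> ` (U \<inter> V)) (\<psi> \<circ> inv_into U \<phi>))"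

definition smooth_functions ::
    "('a::{t2_space,second_countable_topology}, 'e::euclidean_space) chart set \<Rightarrow> ('a \<Rightarrow> real) set" where
  "smooth_functions A = {f. \<forall>(U, \<phi>)\<in>A. smooth_on (\<phi> ` U) (f \<circ> inv_into U \<phi>)}"

section \<open>Tangent vectors and vector fields\<close>

text \<open>Tangent vectors are derivations of the algebra of smooth functions, extended by \<open>0\<close> to
  non-smooth functions so that equality of tangent vectors is equality in HOL. Addition, negation
  and zero of tangent vectors and of vector fields are the pointwise ones.\<close>

type_synonym 'a tvec = "('a \<Rightarrow> real) \<Rightarrow> real"
type_synonym 'a vfield = "'a \<Rightarrow> 'a tvec"

definition tscale :: "real \<Rightarrow> 'a tvec \<Rightarrow> 'a tvec" where
  "tscale c v = (\<lambda>f. c * v f)"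

definition vscale :: "('a \<Rightarrow> real) \<Rightarrow> 'a vfield \<Rightarrow> 'a vfield" where
  "vscale f X = (\<lambda>p. tscale (f p) (X p))"

definition tangent_space ::
    "('a::{t2_space,second_countable_topology}, 'e::euclidean_space) chart set \<Rightarrow> 'a \<Rightarrow> 'a tvec set" where
  "tangent_space A p = {v.
     (\<forall>f\<in>smooth_functions A. \<forall>h\<in>smooth_functions A.
        v (f + h) = v f + v h \<and> v (f * h) = v f * h p + f p * v h) \<and>
     (\<forall>c. \<forall>f\<in>smooth_functions A. v (\<lambda>q. c * f q) = c * v f) \<and>
     (\<forall>f. f \<notin> smooth_functions A \<longrightarrow> v f = 0)}"

definition vector_fields ::
    "('a::{t2_space,second_countable_topology}, 'e::euclidean_space) chart set \<Rightarrow> 'a vfield set" where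
  "vector_fields A = {X. (\<forall>p. X p \<in> tangent_space A p) \<and>
     (\<forall>f\<in>smooth_functions A. (\<lambda>p. X p f) \<in> smooth_functions A)}"

definition lie_bracket :: "'a vfield \<Rightarrow> 'a vfield \<Rightarrow> 'a vfield" where
  "lie_bracket X Y = (\<lambda>p f. X p (\<lambda>q. Y q f) - Y p (\<lambda>q. X q f))"

section \<open>Almost Hermitian structures\<close>

type_synonym 'a metric = "'a \<Rightarrow> 'a tvec \<Rightarrow> 'a tvec \<Rightarrow> real"
type_synonym 'a endo = "'a \<Rightarrow> 'a tvec \<Rightarrow> 'a tvec"

definition riemannian_metric ::
    "('a::{t2_space,second_countable_topology}, 'e::euclidean_space) chart set \<Rightarrow> 'a metric \<Rightarrow> bool" where
  "riemannian_metric A g \<longleftrightarrow>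
     (\<forall>p. \<forall>u\<in>tangent_space A p. \<forall>v\<in>tangent_space A p.
        g p u v = g p v u \<and>
        (\<forall>w\<in>tangent_space A p. g p (u + v) w = g p u w + g p v w) \<and>
        (\<forall>c. g p (tscale c u) v = c * g p u v) \<and>
        (u \<noteq> 0 \<longrightarrow> g p u u > 0)) \<and>
     (\<forall>X\<in>vector_fields A. \<forall>Y\<in>vector_fields A. (\<lambda>p. g p (X p) (Y p)) \<in> smooth_functions A)"

definition app :: "'a endo \<Rightarrow> 'a vfield \<Rightarrow> 'a vfield" where
  "app J X = (\<lambda>p. J p (X p))"

definition almost_complex_structure ::
    "('a::{t2_space,second_countable_topology}, 'e::euclidean_space) chart set \<Rightarrow> 'a endo \<Rightarrow> bool" where
  "almost_complex_structure A J \<longleftrightarrow>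
     (\<forall>p. \<forall>u\<in>tangent_space A p.
        J p u \<in> tangent_space A p \<and>
        (\<forall>v\<in>tangent_space A p. J p (u + v) = J p u + J p v) \<and>
        (\<forall>c. J p (tscale c u) = tscale c (J p u)) \<and>
        J p (J p u) = - u) \<and>
     (\<forall>X\<in>vector_fields A. app J X \<in> vector_fields A)"

definition almost_hermitian ::
    "('a::{t2_space,second_countable_topology}, 'e::euclidean_space) chart set \<Rightarrow>
     'a metric \<Rightarrow> 'a endo \<Rightarrow> bool" where
  "almost_hermitian A g J \<longleftrightarrow>
     smooth_manifold A \<and> riemannian_metric A g \<and> almost_complex_structure A J \<and>
     (\<forall>p. \<forall>u\<in>tangent_space A p. \<forall>v\<in>tangent_space A p. g p (J p u) (J p v) = g p u v)"

section \<open>Connections and curvature\<close>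

text \<open>\<open>D X Y\<close> stands for \<open>\<nabla>\<^sub>X Y\<close>; only its values on smooth vector fields matter.\<close>

type_synonym 'a conn = "'a vfield \<Rightarrow> 'a vfield \<Rightarrow> 'a vfield"

definition affine_connection ::
    "('a::{t2_space,second_countable_topology}, 'e::euclidean_space) chart set \<Rightarrow> 'a conn \<Rightarrow> bool" where
  "affine_connection A D \<longleftrightarrow>
     (\<forall>X\<in>vector_fields A. \<forall>Y\<in>vector_fields A.
        D X Y \<in> vector_fields A \<and>
        (\<forall>Z\<in>vector_fields A. D (X + Y) Z = D X Z + D Y Z \<and> D X (Y + Z) = D X Y + D X Z) \<and>
        (\<forall>f\<in>smooth_functions A.
           D (vscale f X) Y = vscale f (D X Y) \<and>
           D X (vscale f Y) = vscale (\<lambda>p. X p f) Y + vscale f (D X Y)))"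

definition levi_civita ::
    "('a::{t2_space,second_countable_topology}, 'e::euclidean_space) chart set \<Rightarrow>
     'a metric \<Rightarrow> 'a conn \<Rightarrow> bool" where
  "levi_civita A g D \<longleftrightarrow> affine_connection A D \<and>
     (\<forall>X\<in>vector_fields A. \<forall>Y\<in>vector_fields A. D X Y - D Y X = lie_bracket X Y) \<and>
     (\<forall>X\<in>vector_fields A. \<forall>Y\<in>vector_fields A. \<forall>Z\<in>vector_fields A. \<forall>p.
        X p (\<lambda>q. g q (Y q) (Z q)) = g p (D X Y p) (Z p) + g p (Y p) (D X Z p))"

text \<open>Sign convention: \<open>R(X,Y) = \<nabla>\<^bsub>[X,Y]\<^esub> - [\<nabla>\<^sub>X, \<nabla>\<^sub>Y]\<close>.\<close>

definition curv :: "'a conn \<Rightarrow> 'a vfield \<Rightarrow> 'a vfield \<Rightarrow> 'a vfield \<Rightarrow> 'a vfield" where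
  "curv D X Y Z = D (lie_bracket X Y) Z - (D X (D Y Z) - D Y (D X Z))"

definition curv4 :: "'a metric \<Rightarrow> 'a conn \<Rightarrow>
    'a vfield \<Rightarrow> 'a vfield \<Rightarrow> 'a vfield \<Rightarrow> 'a vfield \<Rightarrow> 'a \<Rightarrow> real" where
  "curv4 g D X Y Z U = (\<lambda>p. g p (curv D X Y Z p) (U p))"

text \<open>\<open>nablaJ D J X Y\<close> is \<open>(\<nabla>\<^sub>X J) Y\<close>.\<close>

definition nablaJ :: "'a conn \<Rightarrow> 'a endo \<Rightarrow> 'a vfield \<Rightarrow> 'a vfield \<Rightarrow> 'a vfield" where
  "nablaJ D J X Y = D X (app J Y) - app J (D X Y)"

definition quasi_kaehler ::
    "('a::{t2_space,second_countable_topology}, 'e::euclidean_space) chart set \<Rightarrow>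
     'a endo \<Rightarrow> 'a conn \<Rightarrow> bool" where
  "quasi_kaehler A J D \<longleftrightarrow>
     (\<forall>X\<in>vector_fields A. \<forall>Y\<in>vector_fields A.
        nablaJ D J (app J X) Y = - app J (nablaJ D J X Y))"

definition AH2 ::
    "('a::{t2_space,second_countable_topology}, 'e::euclidean_space) chart set \<Rightarrow>
     'a metric \<Rightarrow> 'a endo \<Rightarrow> 'a conn \<Rightarrow> bool" where
  "AH2 A g J D \<longleftrightarrow>
     (\<forall>X\<in>vector_fields A. \<forall>Y\<in>vector_fields A. \<forall>Z\<in>vector_fields A. \<forall>U\<in>vector_fields A.
        curv4 g D X Y Z U - curv4 g D (app J X) (app J Y) Z U =
        curv4 g D (app J X) Y (app J Z) U + curv4 g D (app J X) Y Z (app J U))"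

section \<open>The first canonical Hermitian connection\<close>

definition eta :: "'a conn \<Rightarrow> 'a endo \<Rightarrow> 'a vfield \<Rightarrow> 'a vfield \<Rightarrow> 'a vfield" where
  "eta D J X Y = vscale (\<lambda>_. 1 / 2) (nablaJ D J X (app J Y))"

definition canonical_conn :: "'a conn \<Rightarrow> 'a endo \<Rightarrow> 'a conn" where
  "canonical_conn D J X Y = D X Y + eta D J X Y"

definition canonical_torsion :: "'a conn \<Rightarrow> 'a endo \<Rightarrow> 'a vfield \<Rightarrow> 'a vfield \<Rightarrow> 'a vfield" where
  "canonical_torsion D J X Y = eta D J X Y - eta D J Y X"

text \<open>Covariant derivative of a (2,1)-tensor \<open>S\<close>: \<open>cov_deriv21 D S V Z W\<close> is \<open>(\<nabla>\<^sub>V S)\<^sub>Z W\<close>.\<close>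

definition cov_deriv21 :: "'a conn \<Rightarrow> ('a vfield \<Rightarrow> 'a vfield \<Rightarrow> 'a vfield) \<Rightarrow>
    'a vfield \<Rightarrow> 'a vfield \<Rightarrow> 'a vfield \<Rightarrow> 'a vfield" where
  "cov_deriv21 D S V Z W = D V (S Z W) - S (D V Z) W - S Z (D V W)"

end

theory Submission
  imports Defs
begin

text \<open>
  Write \<open>B\<^sub>X = \<nabla>'\<^sub>X \<eta>\<close> for the derivative of \<open>\<eta>\<close> along the first canonical connection
  \<open>\<nabla>' = \<nabla> + \<eta>\<close>, and \<open>T\<close>, \<open>R'\<close> for the torsion and curvature of \<open>\<nabla>'\<close>. The idea is to compare
  types. The connection \<open>\<nabla>'\<close> preserves \<open>J\<close>, and on a quasi-Kaehler manifold \<open>\<eta>\<close> is conjugate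
  linear in both arguments, so over the complex numbers \<open>\<eta>\<close> and \<open>T\<close> send a pair of vectors of type (1,0)
  to one of type (0,1), and a pair of mixed type to zero. Substituting \<open>\<nabla> = \<nabla>' - \<eta>\<close> in the
  curvature splits \<open>R(X,Y)\<close> into a part commuting with \<open>J\<close>, made of \<open>R'\<close> and quadratic terms in
  \<open>\<eta>\<close>, and a part anticommuting with \<open>J\<close>, made of \<open>B\<close> and \<open>\<eta>\<^bsub>T(X,Y)\<^esub>\<close>. The second Gray
  identity, which defines the class, equates \<open>R(X,Y) - R(JX,JY)\<close> with the commutator \<open>[R(JX,Y), J]\<close>, which anticommutes with
  \<open>J\<close>. Its commuting part therefore says \<open>R'(JX,JY) = R'(X,Y)\<close>
  (\<open>canonical_curvature_J_invariant\<close>), and its anticommuting part says \<open>B\<^bsub>JX\<^esub> = - J B\<^sub>X\<close>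
  (\<open>deriv_eta_conjugate_linear\<close>): on arguments of type (1,0), \<open>\<eta>\<close> is parallel in all
  directions of type (0,1).

  The Ricci identity for the second derivative \<open>H\<^bsub>X,Y\<^esub>\<close> of \<open>\<eta>\<close> reads
  \<open>H\<^bsub>X,Y\<^esub> - H\<^bsub>Y,X\<^esub> + B\<^bsub>T(X,Y)\<^esub> = - R'(X,Y) \<cdot> \<eta>\<close> (\<open>ricci_identity_eta\<close>). For \<open>X\<close>, \<open>Y\<close> of type
  (0,1) and arguments of type (1,0), the second derivatives vanish because \<open>B\<close> does, and \<open>R'\<close>
  vanishes by its invariance under \<open>J\<close>; hence \<open>B\<close> vanishes in the direction \<open>T(X,Y)\<close>, of type (1,0).
  For \<open>X\<close>, \<open>Y\<close> of type (1,0) it does so as well, \<open>T(X,Y)\<close> being of type (0,1).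

  The argument is carried out with real vector fields, type statements being replaced by
  substitutions of \<open>J\<close>. It takes place in the additive group of vector fields, where one can halve:
  each identity follows from additivity of the operators, the torsion-freeness
  \<open>[X,Y] = \<nabla>\<^sub>X Y - \<nabla>\<^sub>Y X\<close>, and the commutation rules with \<open>J\<close>. The metric enters once, to turn
  the Gray identity for the curvature tensor into one between operators
  (\<open>AH2_operator\<close>): the difference of the two sides is itself a vector field, and pairing it with
  itself shows that it is zero.
\<close>

section \<open>The vector space of vector fields\<close>

text \<open>The derivative at a point of \<open>S\<close> depends on the values in a full neighbourhood of the point;
  this is where openness enters.\<close>

lemma Ck_on_cong:
  assumes "open S" "\<And>x. x \<in> S \<Longrightarrow> f x = h x" "Ck_on k S f"
  shows "Ck_on k S h"
  using assms(2,3)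
proof (induction k arbitrary: f h)
  case 0
  then show ?case by (metis Ck_on.simps(1) continuous_on_cong)
next
  case (Suc k)
  have diff: "h differentiable (at x)" if "x \<in> S" for x
    using Suc.prems that assms(1)
    by (metis Ck_on.simps(2) differentiable_def has_derivative_transform_within_open)
  have eq: "frechet_derivative f (at x) = frechet_derivative h (at x)" if "x \<in> S" for x
    using Suc.prems that assms(1)
    by (intro frechet_derivative_transform_within_open) auto
  have "Ck_on k S (\<lambda>x. frechet_derivative h (at x) v)" for v
    by (rule Suc.IH[of "\<lambda>x. frechet_derivative f (at x) v"])
       (use eq Suc.prems(2) in simp_all)
  with diff show ?case by simp
qed

lemma Ck_on_linear_combination:
  assumes "open S" "Ck_on k S f" "Ck_on k S h"
  shows "Ck_on k S (\<lambda>x. a *\<^sub>R f x + b *\<^sub>R h x)"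
  using assms(2,3)
proof (induction k arbitrary: f h)
  case 0
  then show ?case by (auto intro!: continuous_intros)
next
  case (Suc k)
  have der: "((\<lambda>x. a *\<^sub>R f x + b *\<^sub>R h x) has_derivative
      (\<lambda>v. a *\<^sub>R frechet_derivative f (at x) v + b *\<^sub>R frechet_derivative h (at x) v)) (at x)"
    if "x \<in> S" for x
    using Suc.prems that
    by (intro has_derivative_add has_derivative_scaleR_right)
       (simp_all flip: frechet_derivative_works)
  have "Ck_on k S (\<lambda>x. frechet_derivative (\<lambda>x. a *\<^sub>R f x + b *\<^sub>R h x) (at x) v)" for v
  proof (rule Ck_on_cong[OF assms(1)])
    show "Ck_on k S (\<lambda>x. a *\<^sub>R frechet_derivative f (at x) v + b *\<^sub>R frechet_derivative h (at x) v)"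
      using Suc.prems by (intro Suc.IH) simp_all
    show "a *\<^sub>R frechet_derivative f (at x) v + b *\<^sub>R frechet_derivative h (at x) v =
        frechet_derivative (\<lambda>x. a *\<^sub>R f x + b *\<^sub>R h x) (at x) v" if "x \<in> S" for x
      using frechet_derivative_at[OF der[OF that]] by (rule fun_cong)
  qed
  with der show ?case by (auto simp: differentiable_def)
qed

lemma smooth_functions_linear_combination:
  assumes "smooth_manifold A" "f \<in> smooth_functions A" "h \<in> smooth_functions A"
  shows "(\<lambda>p. a * f p + b * h p) \<in> smooth_functions A"
proof -
  have "smooth_on (\<phi> ` U) ((\<lambda>p. a * f p + b * h p) \<circ> inv_into U \<phi>)" if "(U, \<phi>) \<in> A" for U \<phi>
  proof -
    have "open (\<phi> ` U)" using assms(1) that by (auto simp: smooth_manifold_def)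
    moreover have "smooth_on (\<phi> ` U) (f \<circ> inv_into U \<phi>)" "smooth_on (\<phi> ` U) (h \<circ> inv_into U \<phi>)"
      using assms(2,3) that by (auto simp: smooth_functions_def)
    ultimately show ?thesis
      unfolding smooth_on_def
      using Ck_on_linear_combination[of "\<phi> ` U" _ "f \<circ> inv_into U \<phi>" "h \<circ> inv_into U \<phi>" a b]
      by (simp add: comp_def)
  qed
  then show ?thesis by (auto simp: smooth_functions_def)
qed

lemma tangent_space_linear_combination:
  assumes "u \<in> tangent_space A p" "v \<in> tangent_space A p"
  shows "(\<lambda>f. a * u f + b * v f) \<in> tangent_space A p"
  using assms by (simp add: tangent_space_def algebra_simps)

lemma vector_fields_linear_combination:
  assumes "smooth_manifold A" "X \<in> vector_fields A" "Y \<in> vector_fields A"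
  shows "(\<lambda>p f. a * X p f + b * Y p f) \<in> vector_fields A"
  using assms
  by (auto simp: vector_fields_def
      intro: tangent_space_linear_combination smooth_functions_linear_combination)

text \<open>Additivity is the only form of linearity of the geometric operators that is used; these
  are its consequences for an operator on a subgroup.\<close>

lemma additive_on_diff:
  fixes F :: "'b::ab_group_add \<Rightarrow> 'c::ab_group_add"
  assumes "\<And>x y. x \<in> V \<Longrightarrow> y \<in> V \<Longrightarrow> F (x + y) = F x + F y"
    and "\<And>x y. x \<in> V \<Longrightarrow> y \<in> V \<Longrightarrow> x - y \<in> V"
    and "x \<in> V" "y \<in> V"
  shows "F (x - y) = F x - F y" "F (- x) = - F x"
proof -
  have diff: "F (u - v) = F u - F v" if "u \<in> V" "v \<in> V" for u v
    using assms(1)[of "u - v" v] assms(2)[of u v] that by simp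
  then show "F (x - y) = F x - F y" using assms by blast
  have "0 \<in> V" using assms(2)[of x x] assms(3) by simp
  then show "F (- x) = - F x" using diff[of 0 0] diff[of 0 x] assms(3) by simp
qed

abbreviation half :: "'a vfield \<Rightarrow> 'a vfield" where
  "half \<equiv> vscale (\<lambda>_. 1 / 2)"

lemma half_additive:
  "half (X + Y) = half X + half Y" "half (X - Y) = half X - half Y" "half (- X) = - half X"
  by (simp_all add: fun_eq_iff vscale_def tscale_def algebra_simps add_divide_distrib
      diff_divide_distrib)

lemma half_add_half: "half X + half X = X"
  by (simp add: fun_eq_iff vscale_def tscale_def)

lemma double_eq_zero:
  fixes X :: "'a vfield"
  assumes "X + X = 0"
  shows "X = 0"
  using assms by (simp add: fun_eq_iff)

section \<open>The first canonical connection\<close>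

locale almost_hermitian_manifold =
  fixes A :: "('a::{t2_space,second_countable_topology}, 'e::euclidean_space) chart set"
    and g :: "'a metric" and J :: "'a endo" and D :: "'a conn"
  assumes almost_hermitian: "almost_hermitian A g J"
    and levi_civita: "levi_civita A g D"
begin

abbreviation V :: "'a vfield set" where "V \<equiv> vector_fields A"
abbreviation I :: "'a vfield \<Rightarrow> 'a vfield" where "I \<equiv> app J"
abbreviation \<eta> :: "'a vfield \<Rightarrow> 'a vfield \<Rightarrow> 'a vfield" where "\<eta> \<equiv> eta D J"
abbreviation D' :: "'a conn" where "D' \<equiv> canonical_conn D J"
abbreviation T :: "'a vfield \<Rightarrow> 'a vfield \<Rightarrow> 'a vfield" where "T \<equiv> canonical_torsion D J"
abbreviation B :: "'a vfield \<Rightarrow> 'a vfield \<Rightarrow> 'a vfield \<Rightarrow> 'a vfield"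
  where "B \<equiv> cov_deriv21 D' \<eta>"
abbreviation R :: "'a vfield \<Rightarrow> 'a vfield \<Rightarrow> 'a vfield \<Rightarrow> 'a vfield" where "R \<equiv> curv D"
abbreviation R' :: "'a vfield \<Rightarrow> 'a vfield \<Rightarrow> 'a vfield \<Rightarrow> 'a vfield" where "R' \<equiv> curv D'"

lemma smooth_manifold: "smooth_manifold A"
  using almost_hermitian by (simp add: almost_hermitian_def)

lemma V_closed [simp]:
  assumes "X \<in> V" "Y \<in> V"
  shows "X + Y \<in> V" "X - Y \<in> V" "- X \<in> V" "half X \<in> V"
  using vector_fields_linear_combination[OF smooth_manifold assms, of 1 1]
    vector_fields_linear_combination[OF smooth_manifold assms, of 1 "-1"]
    vector_fields_linear_combination[OF smooth_manifold assms, of "-1" 0]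
    vector_fields_linear_combination[OF smooth_manifold assms, of "1/2" 0]
  by (simp_all add: vscale_def tscale_def plus_fun_def fun_diff_def fun_Compl_def)

lemma V_tangent: "X \<in> V \<Longrightarrow> X p \<in> tangent_space A p"
  by (simp add: vector_fields_def)

lemma I_closed [simp]: "X \<in> V \<Longrightarrow> I X \<in> V"
  using almost_hermitian by (simp add: almost_hermitian_def almost_complex_structure_def)

lemma I_add [simp]: "X \<in> V \<Longrightarrow> Y \<in> V \<Longrightarrow> I (X + Y) = I X + I Y"
  using almost_hermitian V_tangent
  by (intro ext)
     (simp add: almost_hermitian_def almost_complex_structure_def app_def)

lemmas I_diff [simp] = additive_on_diff[where V = V and F = I, OF I_add V_closed(2)]

lemma I_half [simp]: "X \<in> V \<Longrightarrow> I (half X) = half (I X)"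
  using almost_hermitian V_tangent
  by (simp add: almost_hermitian_def almost_complex_structure_def app_def vscale_def)

lemma I_I [simp]: "X \<in> V \<Longrightarrow> I (I X) = - X"
  using almost_hermitian V_tangent
  by (intro ext)
     (simp add: almost_hermitian_def almost_complex_structure_def app_def)

text \<open>Collecting like terms produces integer multiples, written as products with constant
  functions.\<close>

lemma small_multiples [simp]:
  assumes "X \<in> V"
  shows "2 * X \<in> V" "3 * X \<in> V" "I (2 * X) = 2 * I X" "I (3 * X) = 3 * I X"
proof -
  have eq: "2 * Y = Y + Y" "3 * Y = Y + (Y + Y)" for Y :: "'a vfield"
    by (simp_all add: fun_eq_iff)
  show "2 * X \<in> V" "3 * X \<in> V" "I (2 * X) = 2 * I X" "I (3 * X) = 3 * I X"
    unfolding eq using assms by (simp_all only: V_closed I_add I_closed)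
qed

lemma D_closed [simp]: "X \<in> V \<Longrightarrow> Y \<in> V \<Longrightarrow> D X Y \<in> V"
  using levi_civita by (simp add: levi_civita_def affine_connection_def)

lemma D_add [simp]:
  assumes "X \<in> V" "Y \<in> V" "Z \<in> V"
  shows "D (X + Y) Z = D X Z + D Y Z" "D X (Y + Z) = D X Y + D X Z"
  using assms levi_civita by (simp_all add: levi_civita_def affine_connection_def)

lemma D_diff [simp]:
  assumes "X \<in> V" "Y \<in> V" "Z \<in> V"
  shows "D (X - Y) Z = D X Z - D Y Z" "D X (Y - Z) = D X Y - D X Z"
    "D (- X) Z = - D X Z" "D X (- Z) = - D X Z"
  using additive_on_diff[where V = V and F = "\<lambda>X. D X Z"]
    additive_on_diff[where V = V and F = "D X"] assms by simp_all

lemma lie_bracket_eq: "X \<in> V \<Longrightarrow> Y \<in> V \<Longrightarrow> lie_bracket X Y = D X Y - D Y X"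
  using levi_civita by (simp add: levi_civita_def)

lemma eta_eq: "X \<in> V \<Longrightarrow> Y \<in> V \<Longrightarrow> \<eta> X Y = - half (D X Y) - half (I (D X (I Y)))"
  by (simp add: eta_def nablaJ_def half_additive)

lemma eta_closed [simp]: "X \<in> V \<Longrightarrow> Y \<in> V \<Longrightarrow> \<eta> X Y \<in> V"
  by (simp add: eta_eq)

lemma eta_add [simp]:
  assumes "X \<in> V" "Y \<in> V" "Z \<in> V"
  shows "\<eta> (X + Y) Z = \<eta> X Z + \<eta> Y Z" "\<eta> X (Y + Z) = \<eta> X Y + \<eta> X Z"
  using assms by (simp_all add: eta_eq half_additive algebra_simps)

lemma eta_diff [simp]:
  assumes "X \<in> V" "Y \<in> V" "Z \<in> V"
  shows "\<eta> (X - Y) Z = \<eta> X Z - \<eta> Y Z" "\<eta> X (Y - Z) = \<eta> X Y - \<eta> X Z"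
    "\<eta> (- X) Z = - \<eta> X Z" "\<eta> X (- Z) = - \<eta> X Z"
  using additive_on_diff[where V = V and F = "\<lambda>X. \<eta> X Z"]
    additive_on_diff[where V = V and F = "\<eta> X"] assms by simp_all

lemma eta_I_right [simp]: "X \<in> V \<Longrightarrow> Y \<in> V \<Longrightarrow> \<eta> X (I Y) = - I (\<eta> X Y)"
  by (simp add: eta_eq half_additive)

lemma D'_closed [simp]: "X \<in> V \<Longrightarrow> Y \<in> V \<Longrightarrow> D' X Y \<in> V"
  by (simp add: canonical_conn_def)

lemma D'_add [simp]:
  assumes "X \<in> V" "Y \<in> V" "Z \<in> V"
  shows "D' (X + Y) Z = D' X Z + D' Y Z" "D' X (Y + Z) = D' X Y + D' X Z"
  using assms by (simp_all add: canonical_conn_def algebra_simps)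

lemma D'_diff [simp]:
  assumes "X \<in> V" "Y \<in> V" "Z \<in> V"
  shows "D' (X - Y) Z = D' X Z - D' Y Z" "D' X (Y - Z) = D' X Y - D' X Z"
    "D' (- X) Z = - D' X Z" "D' X (- Z) = - D' X Z"
  using additive_on_diff[where V = V and F = "\<lambda>X. D' X Z"]
    additive_on_diff[where V = V and F = "D' X"] assms by simp_all

text \<open>\<open>D'\<^sub>X\<close> is the average of \<open>D\<^sub>X\<close> and its conjugate \<open>- J D\<^sub>X J\<close>.\<close>

lemma canonical_conn_J_parallel [simp]:
  assumes "X \<in> V" "Y \<in> V"
  shows "D' X (I Y) = I (D' X Y)"
proof -
  have avg: "D' X Z = half (D X Z) - half (I (D X (I Z)))" if "Z \<in> V" for Z
    using half_add_half[of "D X Z"] that assms(1)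
    by (simp add: canonical_conn_def eta_eq algebra_simps)
  show ?thesis using assms by (simp add: avg half_additive)
qed

lemma lie_bracket_canonical:
  "X \<in> V \<Longrightarrow> Y \<in> V \<Longrightarrow> lie_bracket X Y = D' X Y - D' Y X - T X Y"
  by (simp add: lie_bracket_eq canonical_conn_def canonical_torsion_def algebra_simps)

lemma torsion_closed [simp]: "X \<in> V \<Longrightarrow> Y \<in> V \<Longrightarrow> T X Y \<in> V"
  by (simp add: canonical_torsion_def)

lemma curv_closed [simp]:
  assumes "X \<in> V" "Y \<in> V" "Z \<in> V"
  shows "R X Y Z \<in> V" "R' X Y Z \<in> V"
  using assms by (simp_all add: curv_def lie_bracket_canonical)

lemma B_closed [simp]: "X \<in> V \<Longrightarrow> Y \<in> V \<Longrightarrow> Z \<in> V \<Longrightarrow> B X Y Z \<in> V"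
  by (simp add: cov_deriv21_def)

lemma B_diff_direction [simp]:
  assumes "X \<in> V" "Y \<in> V" "Z \<in> V" "W \<in> V"
  shows "B (X - Y) Z W = B X Z W - B Y Z W" "B (- X) Z W = - B X Z W"
  using assms by (simp_all add: cov_deriv21_def algebra_simps)

text \<open>Substituting \<open>D = D' - \<eta>\<close> in \<open>R\<close>. The summands are grouped by their behaviour under \<open>J\<close>: as
  operators on \<open>Z\<close>, those in the first group commute with \<open>J\<close>, those in the second anticommute.\<close>

lemma curvature_decomposition:
  assumes "X \<in> V" "Y \<in> V" "Z \<in> V"
  shows "R X Y Z = (R' X Y Z - (\<eta> X (\<eta> Y Z) - \<eta> Y (\<eta> X Z)))
    + (B X Y Z - B Y X Z + \<eta> (T X Y) Z)"
proof -
  have D_eq: "D U W = D' U W - \<eta> U W" for U W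
    by (simp add: canonical_conn_def)
  show ?thesis
    using assms
    by (simp add: curv_def lie_bracket_canonical D_eq cov_deriv21_def algebra_simps)
qed

lemma curv'_I [simp]:
  assumes "X \<in> V" "Y \<in> V" "Z \<in> V"
  shows "R' X Y (I Z) = I (R' X Y Z)"
  using assms by (simp add: curv_def lie_bracket_canonical algebra_simps)

lemma B_I_right [simp]:
  assumes "X \<in> V" "Y \<in> V" "Z \<in> V"
  shows "B X Y (I Z) = - I (B X Y Z)"
  using assms by (simp add: cov_deriv21_def algebra_simps)

text \<open>The second covariant derivative \<open>H\<^bsub>X,Y\<^esub>\<close> of \<open>\<eta>\<close> with respect to \<open>D'\<close>; the correction term
  \<open>B\<^bsub>D'\<^sub>X Y\<^esub>\<close> makes it tensorial in \<open>Y\<close>.\<close>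

definition H :: "'a vfield \<Rightarrow> 'a vfield \<Rightarrow> 'a vfield \<Rightarrow> 'a vfield \<Rightarrow> 'a vfield" where
  "H X Y Z W = D' X (B Y Z W) - B (D' X Y) Z W - B Y (D' X Z) W - B Y Z (D' X W)"

lemma H_closed [simp]: "X \<in> V \<Longrightarrow> Y \<in> V \<Longrightarrow> Z \<in> V \<Longrightarrow> W \<in> V \<Longrightarrow> H X Y Z W \<in> V"
  by (simp add: H_def)

lemma H_minus [simp]:
  assumes "X \<in> V" "Y \<in> V" "Z \<in> V" "W \<in> V"
  shows "H (- X) Y Z W = - H X Y Z W"
  using assms by (simp add: H_def cov_deriv21_def algebra_simps)

text \<open>Antisymmetrizing \<open>H\<close>, the first derivatives of \<open>\<eta>\<close> occur in the direction
  \<open>D'\<^sub>X Y - D'\<^sub>Y X = [X,Y] + T(X,Y)\<close>, while the curvature only accounts for the direction \<open>[X,Y]\<close>;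
  the torsion term is the difference.\<close>

lemma ricci_identity_eta:
  assumes "X \<in> V" "Y \<in> V" "Z \<in> V" "W \<in> V"
  shows "H X Y Z W - H Y X Z W + B (T X Y) Z W =
    - (R' X Y (\<eta> Z W) - \<eta> (R' X Y Z) W - \<eta> Z (R' X Y W))"
  using assms
  by (simp add: H_def curv_def lie_bracket_canonical cov_deriv21_def algebra_simps)

section \<open>From the curvature tensor to the curvature operator\<close>

lemma metric_add_minus:
  assumes "X \<in> V" "Y \<in> V" "Z \<in> V"
  shows "g p (X p + Y p) (Z p) = g p (X p) (Z p) + g p (Y p) (Z p)"
    "g p (X p) (- Z p) = - g p (X p) (Z p)"
proof -
  have metric: "riemannian_metric A g" using almost_hermitian by (simp add: almost_hermitian_def)
  show "g p (X p + Y p) (Z p) = g p (X p) (Z p) + g p (Y p) (Z p)"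
    using metric assms V_tangent by (simp add: riemannian_metric_def)
  have sym: "g p (U p) (W p) = g p (W p) (U p)" if "U \<in> V" "W \<in> V" for U W
    using metric that V_tangent by (simp add: riemannian_metric_def)
  have "- Z p = tscale (-1) (Z p)" by (simp add: tscale_def fun_eq_iff)
  then have "g p (- Z p) (X p) = - g p (Z p) (X p)"
    using metric assms V_tangent by (simp add: riemannian_metric_def)
  then show "g p (X p) (- Z p) = - g p (X p) (Z p)"
    using sym[of X "- Z"] sym[of X Z] assms by simp
qed

lemma metric_diff:
  assumes "X \<in> V" "Y \<in> V" "Z \<in> V"
  shows "g p ((X - Y) p) (Z p) = g p (X p) (Z p) - g p (Y p) (Z p)"
  using metric_add_minus(1)[of "X - Y" Y Z p] assms by simp

lemma metric_I_right:
  assumes "X \<in> V" "Y \<in> V"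
  shows "g p (X p) (I Y p) = - g p (I X p) (Y p)"
proof -
  have "g p (X p) (I Y p) = g p (I X p) (I (I Y) p)"
    using almost_hermitian V_tangent[OF assms(1), of p] V_tangent[OF I_closed[OF assms(2)], of p]
    unfolding almost_hermitian_def app_def by metis
  then show ?thesis using assms metric_add_minus(2)[of "I X" "I X" Y p] by simp
qed

lemma metric_nondegenerate:
  assumes "X \<in> V" "\<And>U p. U \<in> V \<Longrightarrow> g p (X p) (U p) = 0"
  shows "X = 0"
proof
  fix p
  show "X p = 0 p"
    using almost_hermitian V_tangent[OF assms(1), of p] assms(2)[OF assms(1), of p]
    unfolding almost_hermitian_def riemannian_metric_def by (metis less_irrefl zero_fun_apply)
qed

end

section \<open>Consequences of the second Gray identity\<close>

locale quasi_kaehler_AH2_manifold = almost_hermitian_manifold +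
  assumes quasi_kaehler: "quasi_kaehler A J D"
    and AH2: "AH2 A g J D"
begin

lemma eta_I_left [simp]: "X \<in> V \<Longrightarrow> Y \<in> V \<Longrightarrow> \<eta> (I X) Y = - I (\<eta> X Y)"
  using quasi_kaehler
  by (simp add: eta_def quasi_kaehler_def half_additive)
     (simp add: nablaJ_def half_additive)

lemma torsion_I [simp]:
  assumes "X \<in> V" "Y \<in> V"
  shows "T (I X) Y = - I (T X Y)" "T X (I Y) = - I (T X Y)"
  using assms by (simp_all add: canonical_torsion_def)

lemma B_I_left [simp]:
  assumes "X \<in> V" "Y \<in> V" "Z \<in> V"
  shows "B X (I Y) Z = - I (B X Y Z)"
  using assms by (simp add: cov_deriv21_def algebra_simps)

text \<open>In the last term of the defining identity of the class, \<open>J\<close> moves off \<open>U\<close> because it is skew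
  for the metric; as \<open>U\<close> is arbitrary, nondegeneracy then removes it.\<close>

lemma AH2_operator:
  assumes "X \<in> V" "Y \<in> V" "Z \<in> V"
  shows "R X Y Z - R (I X) (I Y) Z = R (I X) Y (I Z) - I (R (I X) Y Z)"
proof -
  let ?S = "(R X Y Z - R (I X) (I Y) Z) - (R (I X) Y (I Z) - I (R (I X) Y Z))"
  have "g p (?S p) (U p) = 0" if "U \<in> V" for U p
  proof -
    have "curv4 g D X Y Z U - curv4 g D (I X) (I Y) Z U =
        curv4 g D (I X) Y (I Z) U + curv4 g D (I X) Y Z (I U)"
      using AH2 assms that by (simp add: AH2_def)
    then have "curv4 g D X Y Z U p - curv4 g D (I X) (I Y) Z U p =
        curv4 g D (I X) Y (I Z) U p + curv4 g D (I X) Y Z (I U) p"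
      by (metis minus_apply plus_fun_apply)
    then show ?thesis
      using assms that by (simp add: metric_diff metric_I_right curv4_def del: minus_apply)
  qed
  then have "?S = 0" using assms by (intro metric_nondegenerate) simp_all
  then show ?thesis by simp
qed

text \<open>The two parts of \<open>curvature_decomposition\<close>: \<open>P X Y\<close> commutes with \<open>J\<close>, and \<open>Q X Y\<close>
  anticommutes with it.\<close>

definition P :: "'a vfield \<Rightarrow> 'a vfield \<Rightarrow> 'a vfield \<Rightarrow> 'a vfield" where
  "P X Y Z = R' X Y Z - (\<eta> X (\<eta> Y Z) - \<eta> Y (\<eta> X Z))"

definition Q :: "'a vfield \<Rightarrow> 'a vfield \<Rightarrow> 'a vfield \<Rightarrow> 'a vfield" where
  "Q X Y Z = B X Y Z - B Y X Z + \<eta> (T X Y) Z"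

lemma PQ_closed [simp]:
  assumes "X \<in> V" "Y \<in> V" "Z \<in> V"
  shows "P X Y Z \<in> V" "Q X Y Z \<in> V"
  using assms by (simp_all add: P_def Q_def)

lemma PQ_I [simp]:
  assumes "X \<in> V" "Y \<in> V" "Z \<in> V"
  shows "P X Y (I Z) = I (P X Y Z)" "Q X Y (I Z) = - I (Q X Y Z)"
  using assms by (simp_all add: P_def Q_def)

lemma curv_PQ: "X \<in> V \<Longrightarrow> Y \<in> V \<Longrightarrow> Z \<in> V \<Longrightarrow> R X Y Z = P X Y Z + Q X Y Z"
  by (simp add: curvature_decomposition P_def Q_def)

text \<open>The right-hand side of \<open>AH2_operator\<close> is a commutator with \<open>J\<close>, in which the part \<open>P\<close>
  drops out and \<open>Q\<close> is doubled. It anticommutes with \<open>J\<close>, so the commuting part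
  \<open>P(X,Y) - P(JX,JY)\<close> of the left-hand side must vanish by itself.\<close>

lemma AH2_parts:
  assumes "X \<in> V" "Y \<in> V" "Z \<in> V"
  shows "P (I X) (I Y) Z = P X Y Z"
    and "Q X Y Z - Q (I X) (I Y) Z = - (I (Q (I X) Y Z) + I (Q (I X) Y Z))"
proof -
  have sum: "P X Y W - P (I X) (I Y) W + (Q X Y W - Q (I X) (I Y) W) =
      - (I (Q (I X) Y W) + I (Q (I X) Y W))" if "W \<in> V" for W
    using AH2_operator[OF assms(1,2) that] assms that by (simp add: curv_PQ algebra_simps)
  \<comment> \<open>Conjugation by \<open>J\<close> fixes the commuting part and reverses the sign of the other one.\<close>
  let ?p = "P X Y Z - P (I X) (I Y) Z" and ?q = "Q X Y Z - Q (I X) (I Y) Z"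
  let ?r = "I (Q (I X) Y Z) + I (Q (I X) Y Z)"
  have 1: "?p + ?q = - ?r" using sum assms by simp
  have "I (?p - ?q) = I ?r"
    using sum[of "I Z"] assms by (simp add: algebra_simps)
  then have "I (I (?p - ?q)) = I (I ?r)" by simp
  then have 2: "?p - ?q = ?r" using assms by (simp add: algebra_simps)
  have "?p + ?p = (?p + ?q) + (?p - ?q)" by (simp add: algebra_simps)
  also have "\<dots> = 0" by (simp only: 1 2) simp
  finally have 3: "?p = 0" by (rule double_eq_zero)
  then show "P (I X) (I Y) Z = P X Y Z" by simp
  from 1 show "?q = - ?r" unfolding 3 by simp
qed

lemma canonical_curvature_J_invariant:
  assumes "X \<in> V" "Y \<in> V" "Z \<in> V"
  shows "R' (I X) (I Y) Z = R' X Y Z"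
  using AH2_parts(1)[OF assms] assms by (simp add: P_def)

text \<open>In the anticommuting part the torsion terms cancel. What is left mixes \<open>B\<^sub>X Y\<close> and \<open>B\<^sub>Y X\<close>;
  the two are separated by substituting \<open>J X\<close> for \<open>X\<close>, which treats the directions and the
  arguments of \<open>B\<close> differently.\<close>

lemma deriv_eta_conjugate_linear [simp]:
  assumes "X \<in> V" "Y \<in> V" "Z \<in> V"
  shows "B (I X) Y Z = - I (B X Y Z)"
proof -
  have mixed: "B U W Z + I (B (I U) W Z) + I (B (I U) W Z) + I (B (I U) W Z) =
      B W U Z + B W U Z + B W U Z + I (B (I W) U Z)" if "U \<in> V" "W \<in> V" for U W
    using AH2_parts(2)[OF that assms(3)] that assms(3) by (simp add: Q_def algebra_simps)
  let ?b = "B X Y Z" and ?c = "I (B (I X) Y Z)"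
  let ?d = "3 * B Y X Z + I (B (I Y) X Z)"
  have 1: "?b + 3 * ?c = ?d"
    using mixed[of X Y] assms by (simp add: algebra_simps)
  have 2: "?c + 3 * ?b = ?d"
    using arg_cong[OF mixed[of "I X" Y], of I] assms by (simp add: algebra_simps)
  have "(?b - ?c) + (?b - ?c) = (?c + 3 * ?b) - (?b + 3 * ?c)" by (simp add: algebra_simps)
  also have "\<dots> = 0" by (simp only: 1 2) simp
  finally have "?b - ?c = 0" by (rule double_eq_zero)
  then have "I ?c = I ?b" by simp
  then show ?thesis using assms by (simp add: minus_equation_iff)
qed

text \<open>This is the derivative of the preceding identity, \<open>J\<close> being parallel for \<open>D'\<close>.\<close>

lemma second_deriv_eta_conjugate_linear [simp]:
  assumes "X \<in> V" "Y \<in> V" "Z \<in> V" "W \<in> V"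
  shows "H X (I Y) Z W = - I (H X Y Z W)"
  using assms by (simp add: H_def)

section \<open>The torsion directions\<close>

text \<open>By the Ricci identity, \<open>F(X,Y) = H\<^bsub>X,Y\<^esub> - H\<^bsub>Y,X\<^esub> + B\<^bsub>T(X,Y)\<^esub>\<close> is invariant under \<open>J\<close>
  acting on both arguments. As \<open>T(JX,JY) = - T(X,Y)\<close>, subtracting \<open>F(X,Y) = F(JX,JY)\<close> leaves
  \<open>2 B\<^bsub>T(X,Y)\<^esub> = K(Y,X) - K(X,Y)\<close> with \<open>K(X,Y) = H\<^bsub>X,Y\<^esub> + J H\<^bsub>JX,Y\<^esub>\<close>, a form that is conjugate
  linear in each argument. But \<open>T\<close> and \<open>B\<close> are each conjugate linear, so \<open>B\<^bsub>T(X,Y)\<^esub>\<close> is complex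
  linear. Both can hold only if it vanishes.\<close>

lemma deriv_eta_torsion_zero:
  assumes "X \<in> V" "Y \<in> V" "Z \<in> V" "W \<in> V"
  shows "B (T X Y) Z W = 0"
proof -
  let ?K = "\<lambda>X Y. H X Y Z W + I (H (I X) Y Z W)" and ?b = "B (T X Y) Z W"
  have invariant: "H (I U) (I Y) Z W - H (I Y) (I U) Z W + B (T (I U) (I Y)) Z W =
      H U Y Z W - H Y U Z W + B (T U Y) Z W" if "U \<in> V" for U
    using assms that
    by (simp only: ricci_identity_eta canonical_curvature_J_invariant I_closed eta_closed)
  have double: "B (T U Y) Z W + B (T U Y) Z W = ?K Y U - ?K U Y" if "U \<in> V" for U
    using invariant[OF that] assms that by (simp add: algebra_simps)
  have "I (?b + ?b) = - I (?K Y X - ?K X Y)"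
    using double[of "I X"] assms by (simp add: algebra_simps)
  then have "I (?b + ?b) = - I (?b + ?b)"
    by (simp only: double[OF assms(1)])
  then have "I (?b + ?b) + I (?b + ?b) = 0"
    by (simp only: eq_neg_iff_add_eq_0)
  then have "I (?b + ?b) = 0" by (rule double_eq_zero)
  then have "I (I (?b + ?b)) = I 0" by (rule arg_cong)
  moreover have "I 0 = 0" using I_diff(1)[of X X] assms by simp
  ultimately have "?b + ?b = 0"
    using assms by (simp only: I_I V_closed B_closed torsion_closed neg_equal_0_iff_equal)
  then show ?thesis by (rule double_eq_zero)
qed

end

theorem proposition3p2:
  fixes A :: "('a::{t2_space,second_countable_topology}, 'e::euclidean_space) chart set"
    and g :: "'a metric" and J :: "'a endo" and D :: "'a conn" and n :: nat
  assumes "DIM('e) = 2 * n"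
    and "almost_hermitian A g J"
    and "levi_civita A g D"
    and "quasi_kaehler A J D"
    and "AH2 A g J D"
  shows "\<forall>X\<in>vector_fields A. \<forall>Y\<in>vector_fields A. \<forall>Z\<in>vector_fields A. \<forall>W\<in>vector_fields A.
           cov_deriv21 (canonical_conn D J) (eta D J) (canonical_torsion D J X Y) Z W = 0"
proof (intro ballI)
  interpret quasi_kaehler_AH2_manifold A g J D
    using assms by unfold_locales
  fix X Y Z W assume "X \<in> V" "Y \<in> V" "Z \<in> V" "W \<in> V"
  then show "B (T X Y) Z W = 0" by (rule deriv_eta_torsion_zero)
qed

end
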